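(* For each $\epsilon>0$ there exist positive constants $C_1(\epsilon), C_2(\epsilon), C_3(\epsilon)$, depending only on $\epsilon$, such that for all integers $n\ge 2$ and all $p\in(0,1)$ with $$C_1(\epsilon)\, n^{-1}\log n\le p\le C_2(\epsilon),$$ the number $T$ of triangles in the Erdős–Rényi random graph $G(n,p)$ satisfies $$\mathbb{P}\big(T\ge (1+\epsilon)\,\mathbb{E}(T)\big)\le e^{-C_3(\epsilon)\, n^2p^2\log(1/p)}.$$
   Context: $G(n,p)$ is the random simple undirected graph on $n$ labelled vertices in which each of the $\binom n2$ possible edges is present independently with probability $p$. A triangle is an unordered triple of distinct vertices that are pairwise joined by edges. $\log$ is the natural logarithm. *)

theory Defs
  imports "HOL-Probability.Probability"
begin

text \<open>A simple undirected graph on the labelled vertices \<open>{..<n}\<close> is represented by its edge set,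
  each edge being the two-element set of its endpoints.\<close>

definition all_edges :: "nat \<Rightarrow> nat set set" where
  "all_edges n = {e. e \<subseteq> {..<n} \<and> card e = 2}"

text \<open>\<open>Pi_pmf\<close> tosses one independent coin per possible edge (its second argument is the dummy value
  outside the index set); the graph consists of the edges whose coin came up \<open>True\<close>.\<close>

definition gnp :: "nat \<Rightarrow> real \<Rightarrow> nat set set pmf" where
  "gnp n p = map_pmf (\<lambda>f. {e \<in> all_edges n. f e})
               (Pi_pmf (all_edges n) False (\<lambda>_. bernoulli_pmf p))"

definition triangles :: "nat \<Rightarrow> nat set set \<Rightarrow> nat set set" where
  "triangles n G =
     {t. t \<subseteq> {..<n} \<and> card t = 3 \<and> (\<forall>u\<in>t. \<forall>v\<in>t. u \<noteq> v \<longrightarrow> {u, v} \<in> G)}"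

definition num_triangles :: "nat \<Rightarrow> nat set set \<Rightarrow> nat" where
  "num_triangles n G = card (triangles n G)"

end

theory Submission
  imports Defs "HOL-Real_Asymp.Real_Asymp"
begin

text \<open>
  The tail probability is split according to whether the random graph contains a small set of edges
  that explains an excess of triangles; this is the method of high moments and cores of
  Harel, Mousset and Samotij. Write \<open>\<mu>\<close> for the mean of \<open>T\<close>, \<open>\<Lambda>\<close> for \<open>ln (1 / p)\<close> and \<open>r\<close> for
  \<open>n\<^sup>2 p\<^sup>2 \<Lambda>\<close>. For a set \<open>I\<close> of edges let \<open>cond_mean I\<close> be the conditional mean of \<open>T\<close> given that
  all edges in \<open>I\<close> are present. A seed is a set of at most \<open>3 k\<close> edges with
  \<open>cond_mean I \<ge> (1 + \<epsilon> / 2) \<mu>\<close>, where \<open>k\<close> is \<open>r\<close> rounded up.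

  If the graph contains no seed, its \<open>k\<close>-th moment can be bounded by revealing triangles one by
  one: the union of those found so far is never a seed, so every further triangle contributes
  a factor of at most \<open>(1 + \<epsilon> / 2) \<mu>\<close> (\<open>moment_le\<close>). Markov's inequality then bounds the
  probability that \<open>T \<ge> (1 + \<epsilon>) \<mu>\<close> without a seed by \<open>((1 + \<epsilon> / 2) / (1 + \<epsilon>)) ^ k\<close>, which is
  exponentially small in \<open>r\<close>.

  If there is a seed, discarding its edges of small influence leaves a core: the conditional mean is
  still at least \<open>(1 + \<epsilon> / 4) \<mu>\<close>, and each edge of the core raises it by at least \<open>\<theta>\<close>, of order
  \<open>n p / \<Lambda>\<close> (\<open>core_exists\<close>). A union bound over cores suffices, for two reasons. A core is
  large: fewer than \<open>c n\<^sup>2 p\<^sup>2\<close> edges cannot create so many triangles (\<open>core_card_gt\<close>).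
  And there are few cores: an edge has influence \<open>\<theta>\<close> only if both endpoints have core degree at least
  of order \<open>n p / \<Lambda>\<close>, or one endpoint has core degree at least of order \<open>n / \<Lambda>\<close>
  (\<open>core_edge_heavy\<close>). Once the heavy vertices are chosen, the \<open>m\<close> edges of a core lie among
  \<open>m\<close> times a power of \<open>\<Lambda>\<close> positions, so that there are at most \<open>p powr (- 3 m / 4)\<close> cores with \<open>m\<close>
  edges, each present with probability \<open>p ^ m\<close> (\<open>heavy_edge_graphs_weight_le\<close>). Choosing up to
  \<open>m \<Lambda> / (n p)\<close> heavy vertices out of \<open>n\<close> costs \<open>exp\<close> of order \<open>m \<Lambda> ln n / (n p)\<close>. This is where
  the condition that \<open>n p\<close> exceed a large multiple of \<open>ln n\<close> enters. The sum over cores is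
  therefore about \<open>exp (- c n\<^sup>2 p\<^sup>2 \<Lambda> / 4)\<close>, again exponentially small in \<open>r\<close>.
\<close>

section \<open>Moments and cores for a random subset of a finite set\<close>

text \<open>
  The random set may be any one that contains each fixed set \<open>I\<close> with probability \<open>p ^ card I\<close>; independence
  of the edges enters through this identity alone. \<open>T\<close> indexes the sets whose appearances are
  counted.
\<close>
locale random_superset =
  fixes M :: "'e set pmf" and E :: "'e set" and p :: real
    and T :: "'t set" and A :: "'t \<Rightarrow> 'e set"
  assumes finite_E: "finite E" and finite_T: "finite T"
    and A_subset: "t \<in> T \<Longrightarrow> A t \<subseteq> E"
    and set_pmf_subset: "set_pmf M \<subseteq> Pow E"
    and p_nonneg: "0 \<le> p"
    and prob_superset: "I \<subseteq> E \<Longrightarrow> measure_pmf.prob M {G. I \<subseteq> G} = p ^ card I"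
begin

definition count :: "'e set \<Rightarrow> nat" where
  "count G = card {t \<in> T. A t \<subseteq> G}"

text \<open>
  The mean of \<open>count\<close> conditioned on the event \<open>I \<subseteq> G\<close>, written out so that it makes sense without
  conditioning.
\<close>
definition cond_mean :: "'e set \<Rightarrow> real" where
  "cond_mean I = (\<Sum>t\<in>T. p ^ card (A t - I))"

definition seed_free :: "nat \<Rightarrow> real \<Rightarrow> 'e set \<Rightarrow> bool" where
  "seed_free L \<tau> G \<longleftrightarrow> (\<forall>I\<subseteq>E. card I \<le> L \<longrightarrow> I \<subseteq> G \<longrightarrow> cond_mean I < \<tau>)"

definition cores :: "nat \<Rightarrow> real \<Rightarrow> real \<Rightarrow> 'e set set" where
  "cores L \<tau> \<theta> = {J. J \<subseteq> E \<and> card J \<le> L \<and> \<tau> \<le> cond_mean J \<and>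
     (\<forall>e\<in>J. \<theta> \<le> cond_mean J - cond_mean (J - {e}))}"

lemma finite_A: "t \<in> T \<Longrightarrow> finite (A t)"
  using A_subset finite_E finite_subset by blast

lemma integrable_M: "integrable (measure_pmf M) (f :: 'e set \<Rightarrow> real)"
  by (rule integrable_measure_pmf_finite)
     (meson finite_E finite_Pow_iff finite_subset set_pmf_subset)

lemma expectation_of_bool:
  "measure_pmf.expectation M (\<lambda>G. of_bool (Q G)) = measure_pmf.prob M {G. Q G}"
proof -
  have "(\<lambda>G. of_bool (Q G) :: real) = indicator {G. Q G}"
    by (auto simp: indicator_def)
  then show ?thesis by simp
qed

lemma count_eq_sum: "real (count G) = (\<Sum>t\<in>T. of_bool (A t \<subseteq> G))"
  by (simp add: count_def finite_T Int_def)

lemma expectation_count: "measure_pmf.expectation M (\<lambda>G. real (count G)) = cond_mean {}"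
  unfolding count_eq_sum cond_mean_def
  by (simp add: Bochner_Integration.integral_sum integrable_M expectation_of_bool
      prob_superset A_subset)

text \<open>
  The set \<open>U\<close> plays the role of the union of the sets \<open>A t\<close> exposed so far. If \<open>U\<close> is a seed, then the
  indicator vanishes. Otherwise one factor \<open>count G\<close> is expanded as a sum over \<open>t\<close>, the induction
  hypothesis is applied to each \<open>U \<union> A t\<close>, and summing \<open>p ^ card (U \<union> A t)\<close> gives
  \<open>p ^ card U * cond_mean U\<close>. The budget \<open>card U + r * k \<le> L\<close> makes sure that every exposed set is
  small enough to be tested by \<open>seed_free\<close>.
\<close>
lemma moment_le:
  assumes "\<And>t. t \<in> T \<Longrightarrow> card (A t) \<le> r" and "0 \<le> \<tau>" and "U \<subseteq> E" and "card U + r * k \<le> L"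
  shows "measure_pmf.expectation M
      (\<lambda>G. real (count G) ^ k * of_bool (seed_free L \<tau> G \<and> U \<subseteq> G)) \<le> \<tau> ^ k * p ^ card U"
  using assms(3,4)
proof (induction k arbitrary: U)
  case 0
  have "measure_pmf.expectation M (\<lambda>G. of_bool (seed_free L \<tau> G \<and> U \<subseteq> G))
      \<le> measure_pmf.prob M {G. U \<subseteq> G}"
    unfolding expectation_of_bool by (rule measure_pmf.finite_measure_mono) auto
  then show ?case using 0 by (simp add: prob_superset)
next
  case (Suc k)
  show ?case
  proof (cases "\<tau> \<le> cond_mean U")
    case True
    have "\<not> (seed_free L \<tau> G \<and> U \<subseteq> G)" for G
    proof -
      have "card U \<le> L" using Suc.prems(2) by linarith
      then show ?thesis unfolding seed_free_def using True Suc.prems(1) by (meson not_less)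
    qed
    then have "(\<lambda>G. real (count G) ^ Suc k * of_bool (seed_free L \<tau> G \<and> U \<subseteq> G)) = (\<lambda>G. 0)"
      by (simp add: fun_eq_iff)
    then show ?thesis using assms(2) p_nonneg by (simp del: power_Suc)
  next
    case False
    have "real (count G) ^ Suc k * of_bool (seed_free L \<tau> G \<and> U \<subseteq> G)
        = (\<Sum>t\<in>T. real (count G) ^ k * of_bool (seed_free L \<tau> G \<and> U \<union> A t \<subseteq> G))" for G
    proof -
      have "real (count G) ^ Suc k * of_bool (seed_free L \<tau> G \<and> U \<subseteq> G)
        = real (count G) ^ k * of_bool (seed_free L \<tau> G \<and> U \<subseteq> G) * (\<Sum>t\<in>T. of_bool (A t \<subseteq> G))"
        by (simp add: count_eq_sum)
      also have "\<dots> = (\<Sum>t\<in>T. real (count G) ^ k * of_bool (seed_free L \<tau> G \<and> U \<union> A t \<subseteq> G))"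
        unfolding sum_distrib_left by (rule sum.cong) auto
      finally show ?thesis .
    qed
    then have "measure_pmf.expectation M
          (\<lambda>G. real (count G) ^ Suc k * of_bool (seed_free L \<tau> G \<and> U \<subseteq> G))
        = (\<Sum>t\<in>T. measure_pmf.expectation M
          (\<lambda>G. real (count G) ^ k * of_bool (seed_free L \<tau> G \<and> U \<union> A t \<subseteq> G)))"
      by (simp add: Bochner_Integration.integral_sum integrable_M del: power_Suc)
    also have "\<dots> \<le> (\<Sum>t\<in>T. \<tau> ^ k * p ^ card (U \<union> A t))"
    proof (rule sum_mono)
      fix t assume t: "t \<in> T"
      have "card (U \<union> A t) \<le> card U + r"
        using card_Un_le[of U "A t"] assms(1)[OF t] by linarith
      then have "card (U \<union> A t) + r * k \<le> L"
        using Suc.prems(2) by simp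
      then show "measure_pmf.expectation M
          (\<lambda>G. real (count G) ^ k * of_bool (seed_free L \<tau> G \<and> U \<union> A t \<subseteq> G))
          \<le> \<tau> ^ k * p ^ card (U \<union> A t)"
        using Suc.prems(1) A_subset[OF t] by (intro Suc.IH) auto
    qed
    also have "\<dots> = \<tau> ^ k * p ^ card U * cond_mean U"
    proof -
      have "card (U \<union> A t) = card U + card (A t - U)" if "t \<in> T" for t
        using card_Un_disjoint[of U "A t - U"] finite_A[OF that]
          finite_subset[OF Suc.prems(1) finite_E] by (simp add: Un_Diff_cancel)
      then show ?thesis
        by (simp add: cond_mean_def sum_distrib_left power_add mult.assoc)
    qed
    also have "\<dots> \<le> \<tau> ^ k * p ^ card U * \<tau>"
      using False assms(2) p_nonneg by (intro mult_left_mono) auto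
    finally show ?thesis by (simp only: power_Suc mult_ac)
  qed
qed

lemma tail_seed_free_le:
  assumes "\<And>t. t \<in> T \<Longrightarrow> card (A t) \<le> r" and "0 \<le> \<tau>" and "0 < x"
  shows "measure_pmf.prob M {G. x \<le> real (count G) \<and> seed_free (r * k) \<tau> G} \<le> (\<tau> / x) ^ k"
proof -
  have "x ^ k * measure_pmf.prob M {G. x \<le> real (count G) \<and> seed_free (r * k) \<tau> G}
      = measure_pmf.expectation M
          (\<lambda>G. x ^ k * of_bool (x \<le> real (count G) \<and> seed_free (r * k) \<tau> G))"
    by (simp add: expectation_of_bool)
  also have "\<dots> \<le> measure_pmf.expectation M
      (\<lambda>G. real (count G) ^ k * of_bool (seed_free (r * k) \<tau> G \<and> {} \<subseteq> G))"
    using assms(3) by (intro integral_mono integrable_M) (auto intro: power_mono)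
  also have "\<dots> \<le> \<tau> ^ k"
    using moment_le[OF assms(1,2), of "{}" k "r * k"] by simp
  finally have "x ^ k * measure_pmf.prob M {G. x \<le> real (count G) \<and> seed_free (r * k) \<tau> G}
      \<le> \<tau> ^ k" .
  then have "measure_pmf.prob M {G. x \<le> real (count G) \<and> seed_free (r * k) \<tau> G} \<le> \<tau> ^ k / x ^ k"
    unfolding pos_le_divide_eq[OF zero_less_power[OF assms(3)]] by (subst mult.commute)
  then show ?thesis by (simp only: power_divide)
qed

text \<open>
  Remove edges of influence below \<open>\<theta>\<close> one at a time; each removal costs less than \<open>\<theta>\<close>, and there are
  at most \<open>card I\<close> removals.
\<close>
lemma core_exists:
  fixes \<tau> \<theta> :: real
  assumes "finite I" and "\<tau> \<le> cond_mean I" and "0 \<le> \<theta>"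
  shows "\<exists>J\<subseteq>I. \<tau> - \<theta> * card I \<le> cond_mean J \<and>
    (\<forall>e\<in>J. \<theta> \<le> cond_mean J - cond_mean (J - {e}))"
  using assms(1,2)
proof (induction I arbitrary: \<tau> rule: finite_psubset_induct)
  case (psubset I)
  show ?case
  proof (cases "\<forall>e\<in>I. \<theta> \<le> cond_mean I - cond_mean (I - {e})")
    case True
    moreover have "0 \<le> \<theta> * card I" using assms(3) by simp
    ultimately show ?thesis using psubset.prems by (intro exI[of _ I]) auto
  next
    case False
    then obtain e where e: "e \<in> I" "cond_mean I - cond_mean (I - {e}) < \<theta>" by auto
    then obtain J where J: "J \<subseteq> I - {e}" "\<tau> - \<theta> - \<theta> * card (I - {e}) \<le> cond_mean J"
      "\<forall>e\<in>J. \<theta> \<le> cond_mean J - cond_mean (J - {e})"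
      using psubset.IH[of "I - {e}" "\<tau> - \<theta>"] psubset.prems by auto
    have "card I = Suc (card (I - {e}))"
      using card.remove[OF psubset.hyps(1) e(1)] .
    then have "real (card I) = real (card (I - {e})) + 1"
      by (simp only: of_nat_Suc)
    then have "\<tau> - \<theta> - \<theta> * card (I - {e}) = \<tau> - \<theta> * card I"
      by (simp only: distrib_left mult_1_right diff_diff_add add.commute)
    then show ?thesis using J by (intro exI[of _ J]) auto
  qed
qed

lemma finite_cores: "finite (cores L \<tau> \<theta>)"
  by (rule finite_subset[of _ "Pow E"]) (auto simp: cores_def finite_E)

theorem upper_tail_le:
  assumes "\<And>t. t \<in> T \<Longrightarrow> card (A t) \<le> r" and "0 \<le> \<tau>" and "0 < x" and "0 \<le> \<theta>"
  shows "measure_pmf.prob M {G. x \<le> real (count G)}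
    \<le> (\<tau> / x) ^ k + (\<Sum>J\<in>cores (r * k) (\<tau> - \<theta> * real (r * k)) \<theta>. p ^ card J)"
proof -
  let ?C = "cores (r * k) (\<tau> - \<theta> * real (r * k)) \<theta>"
  have "\<exists>J\<in>?C. J \<subseteq> G" if not_seed_free: "\<not> seed_free (r * k) \<tau> G" for G
  proof -
    obtain I where I: "I \<subseteq> E" "card I \<le> r * k" "I \<subseteq> G" "\<tau> \<le> cond_mean I"
      using not_seed_free unfolding seed_free_def by (auto simp: not_less)
    have finI: "finite I" using I(1) finite_E finite_subset by blast
    obtain J where J: "J \<subseteq> I" "\<tau> - \<theta> * card I \<le> cond_mean J"
      "\<forall>e\<in>J. \<theta> \<le> cond_mean J - cond_mean (J - {e})"
      using core_exists[OF finI I(4) assms(4)] by auto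
    have "real (card I) \<le> real (r * k)" using I(2) of_nat_le_iff by blast
    then have "\<theta> * card I \<le> \<theta> * real (r * k)"
      using assms(4) by (rule mult_left_mono)
    moreover have "card J \<le> r * k"
      using card_mono[OF finI J(1)] I(2) by linarith
    ultimately show ?thesis
      using I J by (intro bexI[of _ J]) (auto simp: cores_def)
  qed
  then have "{G. x \<le> real (count G)}
      \<subseteq> {G. x \<le> real (count G) \<and> seed_free (r * k) \<tau> G} \<union> (\<Union>J\<in>?C. {G. J \<subseteq> G})"
    by auto
  then have "measure_pmf.prob M {G. x \<le> real (count G)}
      \<le> measure_pmf.prob M ({G. x \<le> real (count G) \<and> seed_free (r * k) \<tau> G}
          \<union> (\<Union>J\<in>?C. {G. J \<subseteq> G}))"
    by (rule measure_pmf.finite_measure_mono) simp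
  also have "\<dots> \<le> measure_pmf.prob M {G. x \<le> real (count G) \<and> seed_free (r * k) \<tau> G}
      + measure_pmf.prob M (\<Union>J\<in>?C. {G. J \<subseteq> G})"
    by (rule measure_Un_le) auto
  also have "\<dots> \<le> (\<tau> / x) ^ k + (\<Sum>J\<in>?C. measure_pmf.prob M {G. J \<subseteq> G})"
  proof (rule add_mono)
    show "measure_pmf.prob M {G. x \<le> real (count G) \<and> seed_free (r * k) \<tau> G} \<le> (\<tau> / x) ^ k"
      using assms(1-3) by (rule tail_seed_free_le)
    show "measure_pmf.prob M (\<Union>J\<in>?C. {G. J \<subseteq> G}) \<le> (\<Sum>J\<in>?C. measure_pmf.prob M {G. J \<subseteq> G})"
      by (rule measure_pmf.finite_measure_subadditive_finite[OF finite_cores]) simp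
  qed
  also have "(\<Sum>J\<in>?C. measure_pmf.prob M {G. J \<subseteq> G}) = (\<Sum>J\<in>?C. p ^ card J)"
    by (rule sum.cong[OF refl], rule prob_superset) (simp add: cores_def)
  finally show ?thesis .
qed

end

section \<open>Triangles and degrees\<close>

definition pairs :: "'a set \<Rightarrow> 'a set set" where
  "pairs t = {e. e \<subseteq> t \<and> card e = 2}"

definition triples :: "nat \<Rightarrow> nat set set" where
  "triples n = {t. t \<subseteq> {..<n} \<and> card t = 3}"

definition degree :: "'a set set \<Rightarrow> 'a \<Rightarrow> nat" where
  "degree J v = card {e \<in> J. v \<in> e}"

lemma finite_pairs: "finite t \<Longrightarrow> finite (pairs t)"
  by (rule finite_subset[of _ "Pow t"]) (auto simp: pairs_def)

lemma card_pairs: "finite t \<Longrightarrow> card (pairs t) = card t choose 2"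
  unfolding pairs_def by (rule n_subsets)

lemma all_edges_eq_pairs: "all_edges n = pairs {..<n}"
  by (simp add: all_edges_def pairs_def)

lemma finite_all_edges: "finite (all_edges n)"
  by (simp add: all_edges_eq_pairs finite_pairs)

lemma edgeE:
  assumes "e \<in> all_edges n" "v \<in> e"
  obtains u where "e = {u, v}" "u \<noteq> v" "u < n" "v < n"
proof -
  obtain a b where "e = {a, b}" "a \<noteq> b"
    using assms(1) unfolding all_edges_def card_2_iff by blast
  then show thesis
    using assms that[of a] that[of b] by (auto simp: all_edges_def insert_commute)
qed

lemma finite_triples: "finite (triples n)"
  by (rule finite_subset[of _ "Pow {..<n}"]) (auto simp: triples_def)

lemma card_triples: "card (triples n) = n choose 3"
  unfolding triples_def using n_subsets[of "{..<n}" 3] by simp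

lemma finite_triple: "t \<in> triples n \<Longrightarrow> finite t"
  unfolding triples_def by (auto intro: finite_subset[OF _ finite_lessThan])

lemma card_pairs_triple: "t \<in> triples n \<Longrightarrow> card (pairs t) = 3"
  by (simp add: card_pairs finite_triple) (simp add: triples_def choose_two)

lemma pairs_triple_subset: "t \<in> triples n \<Longrightarrow> pairs t \<subseteq> all_edges n"
  by (auto simp: triples_def pairs_def all_edges_def)

lemma triangles_eq: "triangles n G = {t \<in> triples n. pairs t \<subseteq> G}"
proof -
  have "(\<forall>u\<in>t. \<forall>v\<in>t. u \<noteq> v \<longrightarrow> {u, v} \<in> G) \<longleftrightarrow> pairs t \<subseteq> G" for t :: "nat set"
  proof -
    have "pairs t = {{u, v} | u v. u \<in> t \<and> v \<in> t \<and> u \<noteq> v}"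
      unfolding pairs_def card_2_iff by auto
    then show ?thesis by (simp only:) blast
  qed
  then show ?thesis by (auto simp: triangles_def triples_def)
qed

lemma prob_gnp_superset:
  assumes "0 \<le> p" "p \<le> 1" "I \<subseteq> all_edges n"
  shows "measure_pmf.prob (gnp n p) {G. I \<subseteq> G} = p ^ card I"
proof -
  let ?B = "\<lambda>e. if e \<in> I then {True} else UNIV"
  have "measure_pmf.prob (gnp n p) {G. I \<subseteq> G}
      = measure_pmf.prob (Pi_pmf (all_edges n) False (\<lambda>_. bernoulli_pmf p)) (Pi (all_edges n) ?B)"
    unfolding gnp_def measure_map_pmf
    by (rule arg_cong[where f = "measure_pmf.prob _"]) (use assms(3) in \<open>auto simp: Pi_iff split: if_splits\<close>)
  also have "\<dots> = (\<Prod>e\<in>all_edges n. if e \<in> I then p else 1)"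
    unfolding measure_Pi_pmf_Pi[OF finite_all_edges]
    by (rule prod.cong) (use assms in \<open>auto simp: measure_pmf_single\<close>)
  also have "\<dots> = p ^ card I"
    using assms(3) finite_all_edges by (simp add: prod.If_cases Int_absorb1)
  finally show ?thesis .
qed

locale triangle_count =
  fixes n :: nat and p :: real
  assumes p_pos: "0 < p" and p_less_1: "p < 1"

sublocale triangle_count \<subseteq> random_superset "gnp n p" "all_edges n" p "triples n" pairs
proof
  show "finite (all_edges n)" by (rule finite_all_edges)
  show "finite (triples n)" by (rule finite_triples)
  show "pairs t \<subseteq> all_edges n" if "t \<in> triples n" for t
    using that by (rule pairs_triple_subset)
  show "set_pmf (gnp n p) \<subseteq> Pow (all_edges n)"
    by (auto simp: gnp_def)
  show "0 \<le> p" using p_pos by simp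
  show "measure_pmf.prob (gnp n p) {G. I \<subseteq> G} = p ^ card I" if "I \<subseteq> all_edges n" for I
    using that p_pos p_less_1 by (intro prob_gnp_superset) simp_all
qed

context triangle_count
begin

lemma num_triangles_eq_count: "num_triangles n G = count G"
  by (simp add: num_triangles_def count_def triangles_eq)

lemma cond_mean_empty: "cond_mean {} = real (n choose 3) * p ^ 3"
  by (simp add: cond_mean_def card_pairs_triple card_triples)

end

lemma sum_degree:
  assumes "J \<subseteq> all_edges n"
  shows "(\<Sum>v<n. degree J v) = 2 * card J"
proof -
  have finJ: "finite J" using assms finite_all_edges finite_subset by blast
  have "(\<Sum>v<n. degree J v) = (\<Sum>v<n. \<Sum>e\<in>J. of_bool (v \<in> e))"
    using finJ by (simp add: degree_def Int_def)
  also have "\<dots> = (\<Sum>e\<in>J. \<Sum>v<n. of_bool (v \<in> e))"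
    by (rule sum.swap)
  also have "\<dots> = (\<Sum>e\<in>J. 2)"
  proof (rule sum.cong)
    fix e assume "e \<in> J"
    then have "e \<subseteq> {..<n}" "card e = 2" using assms by (auto simp: all_edges_def)
    then show "(\<Sum>v<n. of_bool (v \<in> e)) = (2::nat)"
      by (simp add: Int_absorb1)
  qed simp
  finally show ?thesis by simp
qed

lemma card_neighbours_le:
  assumes "finite J"
  shows "card {u. {u, v} \<in> J} \<le> degree J v"
  unfolding degree_def
proof (rule card_inj_on_le)
  show "inj_on (\<lambda>u. {u, v}) {u. {u, v} \<in> J}"
    by (auto simp: inj_on_def doubleton_eq_iff)
qed (use assms in auto)

lemma finite_neighbours:
  assumes "finite J"
  shows "finite {u. {u, v} \<in> J}"
proof (rule finite_imageD)
  show "finite ((\<lambda>u. {u, v}) ` {u. {u, v} \<in> J})"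
    using assms by (rule finite_subset[rotated]) auto
qed (auto simp: inj_on_def doubleton_eq_iff)

lemma card_triples_containing_edge_le:
  assumes "e \<in> all_edges n"
  shows "card {t \<in> triples n. e \<subseteq> t} \<le> n"
proof -
  have "{t \<in> triples n. e \<subseteq> t} \<subseteq> (\<lambda>w. insert w e) ` {..<n}"
  proof
    fix t assume "t \<in> {t \<in> triples n. e \<subseteq> t}"
    then have t: "t \<subseteq> {..<n}" "card t = 3" "e \<subseteq> t" by (auto simp: triples_def)
    have fin: "finite e" "finite t" using t(1,3) finite_subset[OF _ finite_lessThan[of n]] by blast+
    have "card (t - e) = 1"
      using assms t fin by (simp add: card_Diff_subset all_edges_def)
    then obtain w where "t - e = {w}" by (auto simp: card_1_singleton_iff)
    then show "t \<in> (\<lambda>w. insert w e) ` {..<n}" using t by (intro image_eqI[of _ _ w]) auto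
  qed
  then have "card {t \<in> triples n. e \<subseteq> t} \<le> card ((\<lambda>w. insert w e) ` {..<n})"
    by (intro card_mono) auto
  also have "\<dots> \<le> n" using card_image_le[of "{..<n}"] by force
  finally show ?thesis .
qed

text \<open>
  A triangle at \<open>v\<close> is determined by its opposite edge, and also by two neighbours of \<open>v\<close>. The number
  of triangles at \<open>v\<close> is therefore at most \<open>min (s\<^sup>2) (d\<^sup>2) \<le> s d\<close>, with \<open>d\<close> the degree. Summed over
  \<open>v\<close> with \<open>s\<^sup>2 = card J\<close>, this gives the bound of order \<open>card J\<close> to the power \<open>3 / 2\<close> that is
  sharp, up to the constant, for complete graphs.
\<close>
lemma card_triangles_at_le:
  assumes "J \<subseteq> all_edges n" and "real (card J) \<le> s\<^sup>2" and "0 \<le> s"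
  shows "real (card {t \<in> triples n. pairs t \<subseteq> J \<and> v \<in> t}) \<le> s * real (degree J v)"
proof -
  let ?T = "{t \<in> triples n. pairs t \<subseteq> J \<and> v \<in> t}"
  have finJ: "finite J" using assms(1) finite_all_edges finite_subset by blast
  have inj: "inj_on (\<lambda>t. t - {v}) ?T"
    by (auto simp: inj_on_def)
  have img: "t - {v} \<in> pairs {u. {u, v} \<in> J} \<inter> J" if "t \<in> ?T" for t
  proof -
    have t: "card t = 3" "v \<in> t" "pairs t \<subseteq> J" "finite t"
      using that finite_triple[of t n] by (simp_all add: triples_def)
    have "card (t - {v}) = 2" using t by simp
    moreover have "{u, v} \<in> J" if "u \<in> t - {v}" for u
      using that t by (auto simp: pairs_def)
    ultimately show ?thesis using t by (auto simp: pairs_def)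
  qed
  have "card ?T \<le> card (pairs {u. {u, v} \<in> J})"
    using img by (intro card_inj_on_le[OF inj]) (auto intro: finite_pairs finite_neighbours finJ)
  also have "\<dots> \<le> (card {u. {u, v} \<in> J})\<^sup>2"
    by (simp add: card_pairs finite_neighbours finJ choose_two power2_eq_square)
      (meson diff_le_self div_le_dividend le_trans mult_le_mono2)
  also have "\<dots> \<le> (degree J v)\<^sup>2"
    by (rule power_mono[OF card_neighbours_le[OF finJ]]) simp
  finally have deg: "real (card ?T) \<le> (real (degree J v))\<^sup>2"
    by (metis of_nat_le_iff of_nat_power)
  have "card ?T \<le> card J"
    using img by (intro card_inj_on_le[OF inj]) (auto intro: finJ)
  then have edges: "real (card ?T) \<le> s\<^sup>2" using assms(2) by linarith
  show ?thesis
  proof (cases "real (degree J v) \<le> s")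
    case True
    then have "(real (degree J v))\<^sup>2 \<le> s * real (degree J v)"
      by (simp add: power2_eq_square mult_right_mono)
    then show ?thesis using deg by linarith
  next
    case False
    then have "s\<^sup>2 \<le> s * real (degree J v)"
      using assms(3) by (simp add: power2_eq_square mult_left_mono)
    then show ?thesis using edges by linarith
  qed
qed

lemma card_triangles_le:
  assumes "J \<subseteq> all_edges n" and "real (card J) \<le> s\<^sup>2" and "0 \<le> s"
  shows "real (card {t \<in> triples n. pairs t \<subseteq> J}) \<le> 2 * s * real (card J)"
proof -
  have "{t \<in> triples n. pairs t \<subseteq> J} \<subseteq> (\<Union>v<n. {t \<in> triples n. pairs t \<subseteq> J \<and> v \<in> t})"
  proof
    fix t assume t: "t \<in> {t \<in> triples n. pairs t \<subseteq> J}"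
    then have "t \<noteq> {}" by (auto simp: triples_def)
    then obtain v where "v \<in> t" by blast
    then show "t \<in> (\<Union>v<n. {t \<in> triples n. pairs t \<subseteq> J \<and> v \<in> t})"
      using t by (auto simp: triples_def)
  qed
  then have "card {t \<in> triples n. pairs t \<subseteq> J}
      \<le> card (\<Union>v<n. {t \<in> triples n. pairs t \<subseteq> J \<and> v \<in> t})"
    by (intro card_mono) (auto simp: finite_triples)
  also have "\<dots> \<le> (\<Sum>v<n. card {t \<in> triples n. pairs t \<subseteq> J \<and> v \<in> t})"
    by (rule card_UN_le) simp
  finally have "real (card {t \<in> triples n. pairs t \<subseteq> J})
      \<le> real (\<Sum>v<n. card {t \<in> triples n. pairs t \<subseteq> J \<and> v \<in> t})"
    by (rule of_nat_mono)
  also have "\<dots> = (\<Sum>v<n. real (card {t \<in> triples n. pairs t \<subseteq> J \<and> v \<in> t}))"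
    by (rule of_nat_sum)
  also have "\<dots> \<le> (\<Sum>v<n. s * real (degree J v))"
    by (intro sum_mono card_triangles_at_le assms)
  also have "\<dots> = s * real (\<Sum>v<n. degree J v)"
    by (simp add: sum_distrib_left)
  also have "\<dots> = 2 * s * real (card J)"
    by (simp add: sum_degree[OF assms(1)])
  finally show ?thesis .
qed

context triangle_count
begin

text \<open>
  Planting \<open>J\<close> raises the probability of a triangle by at most \<open>p\<^sup>2\<close>, \<open>p\<close> or \<open>1\<close> when it contains one,
  two or three edges of \<open>J\<close>. Triangles of the first two kinds are paid for by incidences with \<open>J\<close>, of
  which there are at most \<open>n * card J\<close>; those of the third kind are counted by \<open>card_triangles_le\<close>.
\<close>
lemma cond_mean_excess_le:
  assumes J: "J \<subseteq> all_edges n" and "real (card J) \<le> s\<^sup>2" and "0 \<le> s"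
  shows "cond_mean J - cond_mean {} \<le> real (card J) * (p * real n + 2 * s)"
proof -
  have finJ: "finite J" using J finite_all_edges finite_subset by blast
  have triple: "p ^ card (pairs t - J) - p ^ card (pairs t - {})
      \<le> p * real (card {e \<in> J. e \<subseteq> t}) + of_bool (pairs t \<subseteq> J)" if t: "t \<in> triples n" for t
  proof -
    have fin: "finite (pairs t)" using t by (simp add: finite_triple finite_pairs)
    have c3: "card (pairs t) = 3" using t by (rule card_pairs_triple)
    have eq: "{e \<in> J. e \<subseteq> t} = pairs t \<inter> J"
      using J by (auto simp: pairs_def all_edges_def)
    have split: "card (pairs t \<inter> J) + card (pairs t - J) = 3"
      using card_Int_Diff[OF fin, of J] c3 by simp
    have p2: "p\<^sup>2 \<le> p" using p_pos p_less_1 by (simp add: power2_eq_square)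
    have p3: "0 \<le> p ^ 3" using p_pos by simp
    consider "card (pairs t - J) = 0" | "card (pairs t - J) = 1" | "card (pairs t - J) = 2"
      | "card (pairs t - J) = 3" using split by linarith
    then show ?thesis
    proof cases
      case 1
      then have "pairs t \<subseteq> J" using fin by simp
      then have "p ^ card (pairs t - J) - p ^ card (pairs t - {}) \<le> of_bool (pairs t \<subseteq> J)"
        using 1 p3 by (simp add: c3)
      moreover have "0 \<le> p * real (card {e \<in> J. e \<subseteq> t})" using p_pos by simp
      ultimately show ?thesis by linarith
    next
      case 2
      then have "card (pairs t \<inter> J) = 2" using split by linarith
      then have "p * real (card {e \<in> J. e \<subseteq> t}) = 2 * p" using eq by simp
      moreover have "p ^ card (pairs t - J) - p ^ card (pairs t - {}) \<le> p" using 2 p3 by (simp add: c3)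
      ultimately show ?thesis using p_pos by simp
    next
      case 3
      then have "card (pairs t \<inter> J) = 1" using split by linarith
      then have "p * real (card {e \<in> J. e \<subseteq> t}) = p" using eq by simp
      moreover have "p ^ card (pairs t - J) - p ^ card (pairs t - {}) \<le> p"
        using p2 p3 unfolding 3 c3 Diff_empty by linarith
      moreover have "(0::real) \<le> of_bool (pairs t \<subseteq> J)" by simp
      ultimately show ?thesis by linarith
    next
      case 4
      then show ?thesis using p_pos by (simp add: c3)
    qed
  qed
  have "(\<Sum>t\<in>triples n. card {e \<in> J. e \<subseteq> t})
      = (\<Sum>t\<in>triples n. \<Sum>e\<in>J. of_bool (e \<subseteq> t))"
    using finJ by (simp add: Int_def)
  also have "\<dots> = (\<Sum>e\<in>J. \<Sum>t\<in>triples n. of_bool (e \<subseteq> t))"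
    by (rule sum.swap)
  also have "\<dots> = (\<Sum>e\<in>J. card {t \<in> triples n. e \<subseteq> t})"
    by (simp add: finite_triples Int_def)
  also have "\<dots> \<le> (\<Sum>e\<in>J. n)"
    using J by (intro sum_mono card_triples_containing_edge_le) auto
  finally have inc: "(\<Sum>t\<in>triples n. card {e \<in> J. e \<subseteq> t}) \<le> card J * n" by simp
  have "cond_mean J - cond_mean {}
      = (\<Sum>t\<in>triples n. p ^ card (pairs t - J) - p ^ card (pairs t - {}))"
    by (simp add: cond_mean_def sum_subtractf)
  also have "\<dots> \<le> (\<Sum>t\<in>triples n. p * real (card {e \<in> J. e \<subseteq> t}) + of_bool (pairs t \<subseteq> J))"
    by (intro sum_mono triple)
  also have "\<dots> = p * real (\<Sum>t\<in>triples n. card {e \<in> J. e \<subseteq> t})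
      + real (card {t \<in> triples n. pairs t \<subseteq> J})"
    by (simp add: sum.distrib sum_distrib_left finite_triples Int_def)
  also have "\<dots> \<le> p * real (card J * n) + 2 * s * real (card J)"
    using inc p_pos by (intro add_mono mult_left_mono card_triangles_le assms) (auto simp del: of_nat_sum of_nat_mult)
  finally show ?thesis by (simp add: algebra_simps)
qed

text \<open>
  Only triangles through \<open>{u, v}\<close> matter, one for each third vertex \<open>w\<close>. Its probability is at most
  \<open>p\<^sup>2\<close>, \<open>p\<close> or \<open>1\<close>, depending on how many of the edges \<open>{w, u}\<close> and \<open>{w, v}\<close> belong to \<open>J\<close>. The
  common neighbours of \<open>u\<close> and \<open>v\<close> are counted by the degree of \<open>v\<close>, and since the roles of
  \<open>u\<close> and \<open>v\<close> can be exchanged, by the smaller of the two degrees.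
\<close>
lemma cond_mean_remove_edge_le:
  assumes J: "J \<subseteq> all_edges n" and e: "{u, v} \<in> J"
  shows "cond_mean J - cond_mean (J - {{u, v}})
    \<le> real n * p\<^sup>2 + p * (real (degree J u) + real (degree J v)) + real (degree J v)"
proof -
  have finJ: "finite J" using J finite_all_edges finite_subset by blast
  have c2: "card {u, v} = 2" using J e by (auto simp: all_edges_def)
  have uv: "u \<noteq> v" "u < n" "v < n" "card {u, v} = 2"
    using J e c2 by (auto simp: all_edges_def)
  let ?N = "\<lambda>x. {w. {w, x} \<in> J}"
  let ?W = "{..<n} - {u, v}"
  let ?f = "\<lambda>w. insert w {u, v}"
  have zero: "p ^ card (pairs t - J) - p ^ card (pairs t - (J - {{u, v}})) = 0"
    if "t \<in> triples n" "\<not> {u, v} \<subseteq> t" for t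
  proof -
    have "pairs t - J = pairs t - (J - {{u, v}})" using that by (auto simp: pairs_def)
    then show ?thesis by simp
  qed
  have img: "{t \<in> triples n. {u, v} \<subseteq> t} = ?f ` ?W"
  proof (intro equalityI subsetI)
    fix t assume "t \<in> {t \<in> triples n. {u, v} \<subseteq> t}"
    then have t: "t \<subseteq> {..<n}" "card t = 3" "{u, v} \<subseteq> t" "finite t"
      using finite_triple[of t n] by (simp_all add: triples_def)
    have "card (t - {u, v}) = 1"
      using t uv(4) by (simp add: card_Diff_subset)
    then obtain w where "t - {u, v} = {w}" by (auto simp: card_1_singleton_iff)
    then show "t \<in> ?f ` ?W" using t by (intro image_eqI[of _ _ w]) auto
  next
    fix t assume "t \<in> ?f ` ?W"
    then show "t \<in> {t \<in> triples n. {u, v} \<subseteq> t}"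
      using uv by (auto simp: triples_def)
  qed
  have inj: "inj_on ?f ?W" by (auto simp: inj_on_def)
  have apex: "p ^ card (pairs (?f w) - J)
      \<le> p\<^sup>2 + p * of_bool (w \<in> ?N u) + p * of_bool (w \<in> ?N v) + of_bool (w \<in> ?N v)"
    if w: "w \<in> ?W" for w
  proof -
    have eq: "pairs (?f w) - J = {{w, u}, {w, v}} - J"
    proof -
      have "pairs (?f w) = {{u, v}, {w, u}, {w, v}}"
        using w uv(1) by (auto simp: pairs_def card_2_iff)
      then show ?thesis using e by auto
    qed
    have ne: "{w, u} \<noteq> {w, v}" using uv(1) by (auto simp: doubleton_eq_iff)
    show ?thesis
    proof (cases "{w, v} \<in> J")
      case True
      have "p ^ card (pairs (?f w) - J) \<le> 1"
        using p_pos p_less_1 by (intro power_le_one) auto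
      then show ?thesis using True p_pos by (simp add: add_increasing)
    next
      case False
      show ?thesis
      proof (cases "{w, u} \<in> J")
        case True
        then have "pairs (?f w) - J = {{w, v}}" using eq False by auto
        then show ?thesis using True False by simp
      next
        case nu: False
        then have "pairs (?f w) - J = {{w, u}, {w, v}}" using eq False by auto
        then have "card (pairs (?f w) - J) = 2" using ne by simp
        then show ?thesis using nu False by simp
      qed
    qed
  qed
  have cnt: "(\<Sum>w\<in>?W. of_bool (w \<in> ?N x)) \<le> real (degree J x)" for x
  proof -
    have "(\<Sum>w\<in>?W. of_bool (w \<in> ?N x)) = real (card (?W \<inter> ?N x))"
      by simp
    also have "\<dots> \<le> real (card (?N x))"
      by (simp add: card_mono finite_neighbours[OF finJ])
    also have "\<dots> \<le> real (degree J x)" using card_neighbours_le[OF finJ, of x] by simp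
    finally show ?thesis .
  qed
  have "cond_mean J - cond_mean (J - {{u, v}})
      = (\<Sum>t\<in>triples n. p ^ card (pairs t - J) - p ^ card (pairs t - (J - {{u, v}})))"
    by (simp add: cond_mean_def sum_subtractf)
  also have "\<dots> = (\<Sum>t\<in>{t \<in> triples n. {u, v} \<subseteq> t}.
      p ^ card (pairs t - J) - p ^ card (pairs t - (J - {{u, v}})))"
    using zero by (intro sum.mono_neutral_right) (auto simp: finite_triples)
  also have "\<dots> \<le> (\<Sum>t\<in>{t \<in> triples n. {u, v} \<subseteq> t}. p ^ card (pairs t - J))"
    using p_pos by (intro sum_mono) simp
  also have "\<dots> = (\<Sum>w\<in>?W. p ^ card (pairs (?f w) - J))"
    unfolding img by (simp add: sum.reindex[OF inj])
  also have "\<dots> \<le> (\<Sum>w\<in>?W. p\<^sup>2 + p * of_bool (w \<in> ?N u) + p * of_bool (w \<in> ?N v)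
      + of_bool (w \<in> ?N v))"
    by (intro sum_mono apex)
  also have "\<dots> = real (card ?W) * p\<^sup>2 + p * (\<Sum>w\<in>?W. of_bool (w \<in> ?N u))
      + p * (\<Sum>w\<in>?W. of_bool (w \<in> ?N v)) + (\<Sum>w\<in>?W. of_bool (w \<in> ?N v))"
    by (simp only: sum.distrib sum_distrib_left sum_constant)
  also have "\<dots> \<le> real n * p\<^sup>2 + p * real (degree J u) + p * real (degree J v) + real (degree J v)"
  proof -
    have "card ?W \<le> n" using card_mono[of "{..<n}" ?W] by auto
    then show ?thesis
      using p_pos by (intro add_mono mult_left_mono mult_right_mono cnt) auto
  qed
  finally show ?thesis by (simp add: algebra_simps)
qed

end

section \<open>Counting graphs whose edges meet heavy vertices\<close>

lemma sum_power_card_Pow: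
  assumes "finite X"
  shows "(\<Sum>S\<in>Pow X. y ^ card S) = (1 + y :: real) ^ card X"
  using prod_add[OF assms, of "\<lambda>_. y" "\<lambda>_. 1"] by (simp add: add.commute)

text \<open>
  An exponential Markov bound: each set counted has \<open>x ^ card S \<ge> x powr k\<close>, while \<open>x ^ card S\<close> sums
  over all subsets to \<open>(1 + x) ^ card X\<close>. It is used with \<open>x = 1 / n\<close> for sets of heavy vertices and
  with \<open>x = sqrt p\<close> for sets of edges.
\<close>
lemma card_small_subsets_le:
  fixes x k :: real
  assumes "finite X" and "0 < x" and "x \<le> 1"
  shows "real (card {S. S \<subseteq> X \<and> real (card S) \<le> k}) \<le> exp (x * real (card X) + k * ln (1 / x))"
proof -
  let ?F = "{S. S \<subseteq> X \<and> real (card S) \<le> k}"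
  have "real (card ?F) * exp (k * ln x) = (\<Sum>S\<in>?F. exp (k * ln x))"
    by simp
  also have "\<dots> \<le> (\<Sum>S\<in>?F. x ^ card S)"
  proof (rule sum_mono)
    fix S assume "S \<in> ?F"
    then have "k * ln x \<le> real (card S) * ln x"
      using assms(2,3) by (intro mult_right_mono_neg) auto
    then have "exp (k * ln x) \<le> exp (real (card S) * ln x)" by simp
    also have "\<dots> = x ^ card S" using assms(2) by (simp add: exp_of_nat_mult)
    finally show "exp (k * ln x) \<le> x ^ card S" .
  qed
  also have "\<dots> \<le> (\<Sum>S\<in>Pow X. x ^ card S)"
    using assms(1,2) by (intro sum_mono2) auto
  also have "\<dots> = (1 + x) ^ card X"
    by (rule sum_power_card_Pow[OF assms(1)])
  also have "\<dots> \<le> exp x ^ card X"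
    using assms(2) by (intro power_mono) auto
  also have "\<dots> = exp (x * real (card X))"
    by (simp add: exp_of_nat_mult[symmetric] mult.commute)
  finally have "real (card ?F) \<le> exp (x * real (card X)) / exp (k * ln x)"
    by (simp add: pos_le_divide_eq)
  then show ?thesis
    using assms(2) by (simp add: exp_diff[symmetric] ln_div)
qed

definition heavy :: "nat \<Rightarrow> nat set set \<Rightarrow> real \<Rightarrow> nat set" where
  "heavy n J a = {v. v < n \<and> a \<le> real (degree J v)}"

lemma card_heavy_le:
  assumes "J \<subseteq> all_edges n" and "0 < a"
  shows "real (card (heavy n J a)) \<le> 2 * real (card J) / a"
proof -
  have "real (card (heavy n J a)) * a = (\<Sum>v\<in>heavy n J a. a)"
    by simp
  also have "\<dots> \<le> (\<Sum>v\<in>heavy n J a. real (degree J v))"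
    by (rule sum_mono) (simp add: heavy_def)
  also have "\<dots> \<le> (\<Sum>v<n. real (degree J v))"
    by (rule sum_mono2) (auto simp: heavy_def)
  also have "\<dots> = 2 * real (card J)"
    using sum_degree[OF assms(1)] by (metis of_nat_mult of_nat_numeral of_nat_sum)
  finally show ?thesis using assms(2) by (simp add: pos_le_divide_eq)
qed

definition region :: "nat \<Rightarrow> nat set \<Rightarrow> nat set \<Rightarrow> nat set set" where
  "region n S R = {e \<in> all_edges n. e \<subseteq> S \<or> e \<inter> R \<noteq> {}}"

lemma card_region_le:
  assumes "S \<subseteq> {..<n}" and "R \<subseteq> {..<n}"
  shows "card (region n S R) \<le> (card S)\<^sup>2 + n * card R"
proof -
  have fin: "finite S" "finite R" using assms finite_subset by blast+
  have "region n S R \<subseteq> (\<lambda>(u, v). {u, v}) ` (S \<times> S \<union> R \<times> {..<n})"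
  proof
    fix e assume e: "e \<in> region n S R"
    then have edge: "e \<in> all_edges n" by (simp add: region_def)
    show "e \<in> (\<lambda>(u, v). {u, v}) ` (S \<times> S \<union> R \<times> {..<n})"
    proof (cases "e \<subseteq> S")
      case True
      obtain u v where "e = {u, v}" using edge by (auto simp: all_edges_def card_2_iff)
      then show ?thesis using True by auto
    next
      case False
      then obtain v where v: "v \<in> e" "v \<in> R" using e by (auto simp: region_def)
      then obtain u where "e = {u, v}" "u < n" using edgeE[OF edge v(1)] by metis
      then show ?thesis using v(2) by (intro image_eqI[of _ _ "(v, u)"]) auto
    qed
  qed
  then have "card (region n S R) \<le> card ((\<lambda>(u, v). {u, v}) ` (S \<times> S \<union> R \<times> {..<n}))"
    by (intro card_mono) (auto simp: fin)
  also have "\<dots> \<le> card (S \<times> S \<union> R \<times> {..<n})"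
    by (intro card_image_le) (auto simp: fin)
  also have "\<dots> \<le> card (S \<times> S) + card (R \<times> {..<n})"
    by (rule card_Un_le)
  finally show ?thesis by (simp add: card_cartesian_product power2_eq_square mult.commute)
qed

definition heavy_edge_graphs :: "nat \<Rightarrow> real \<Rightarrow> real \<Rightarrow> nat \<Rightarrow> nat set set set" where
  "heavy_edge_graphs n a b m = {J. J \<subseteq> all_edges n \<and> card J = m \<and>
     (\<forall>e\<in>J. e \<subseteq> heavy n J a \<or> e \<inter> heavy n J b \<noteq> {})}"

text \<open>
  Such a graph is encoded by its two sets of heavy vertices, of size at most \<open>k\<close> and \<open>l\<close>, together with
  a choice of \<open>m\<close> edges in the region that these sets span, which has at most \<open>k\<^sup>2 + n l\<close> elements.
\<close>
lemma card_heavy_edge_graphs_le: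
  assumes "0 < n" and a: "0 < a" and b: "0 < b" and x: "0 < x" "x \<le> 1"
    and k: "k = 2 * real m / a" and l: "l = 2 * real m / b"
  shows "real (card (heavy_edge_graphs n a b m))
    \<le> exp (2 + (k + l) * ln (real n) + x * (k\<^sup>2 + real n * l) + real m * ln (1 / x))"
proof -
  let ?V = "\<lambda>k. {S. S \<subseteq> {..<n} \<and> real (card S) \<le> k}"
  let ?K = "\<lambda>S R. {J. J \<subseteq> region n S R \<and> real (card J) \<le> real m}"
  let ?bd = "exp (x * (k\<^sup>2 + real n * l) + real m * ln (1 / x))"
  have fin_region: "finite (region n S R)" for S R
    by (rule finite_subset[OF _ finite_all_edges[of n]]) (auto simp: region_def)
  have fin_K: "finite (?K S R)" for S R
    by (rule finite_subset[of _ "Pow (region n S R)"]) (auto simp: fin_region)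
  have fin_V: "finite (?V c)" for c
    by (rule finite_subset[of _ "Pow {..<n}"]) auto
  have V: "real (card (?V c)) \<le> exp (1 + c * ln (real n))" for c
    using card_small_subsets_le[of "{..<n}" "1 / real n" c] assms(1) by simp
  have K: "real (card (?K S R)) \<le> ?bd" if "S \<in> ?V k" "R \<in> ?V l" for S R
  proof -
    have "real (card (region n S R)) \<le> real ((card S)\<^sup>2 + n * card R)"
      using card_region_le[of S n R] that of_nat_le_iff by blast
    also have "\<dots> = (real (card S))\<^sup>2 + real n * real (card R)"
      by simp
    also have "\<dots> \<le> k\<^sup>2 + real n * l"
      using that by (intro add_mono power_mono mult_left_mono) auto
    finally have "x * real (card (region n S R)) \<le> x * (k\<^sup>2 + real n * l)"
      using x(1) by simp
    then have "exp (x * real (card (region n S R)) + real m * ln (1 / x)) \<le> ?bd"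
      by simp
    then show ?thesis
      using card_small_subsets_le[OF fin_region x, of S R "real m"] by linarith
  qed
  have "heavy_edge_graphs n a b m \<subseteq> (\<Union>S\<in>?V k. \<Union>R\<in>?V l. ?K S R)"
  proof
    fix J assume J: "J \<in> heavy_edge_graphs n a b m"
    then have sub: "J \<subseteq> all_edges n" and m: "card J = m" by (auto simp: heavy_edge_graphs_def)
    have "heavy n J a \<in> ?V k" "heavy n J b \<in> ?V l"
      using card_heavy_le[OF sub a] card_heavy_le[OF sub b] unfolding k l m
      by (auto simp: heavy_def)
    moreover have "J \<in> ?K (heavy n J a) (heavy n J b)"
      using J by (auto simp: heavy_edge_graphs_def region_def)
    ultimately show "J \<in> (\<Union>S\<in>?V k. \<Union>R\<in>?V l. ?K S R)" by blast
  qed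
  then have "card (heavy_edge_graphs n a b m) \<le> card (\<Union>S\<in>?V k. \<Union>R\<in>?V l. ?K S R)"
    by (intro card_mono finite_UN_I fin_V fin_K) auto
  also have "\<dots> \<le> (\<Sum>S\<in>?V k. \<Sum>R\<in>?V l. card (?K S R))"
    by (intro order_trans[OF card_UN_le[OF fin_V]] sum_mono card_UN_le fin_V)
  finally have "real (card (heavy_edge_graphs n a b m))
      \<le> real (\<Sum>S\<in>?V k. \<Sum>R\<in>?V l. card (?K S R))"
    by (rule of_nat_mono)
  also have "\<dots> = (\<Sum>S\<in>?V k. \<Sum>R\<in>?V l. real (card (?K S R)))"
    by simp
  also have "\<dots> \<le> (\<Sum>S\<in>?V k. \<Sum>R\<in>?V l. ?bd)"
    by (intro sum_mono K)
  also have "\<dots> = real (card (?V k)) * real (card (?V l)) * ?bd"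
    by simp
  also have "\<dots> \<le> exp (1 + k * ln (real n)) * exp (1 + l * ln (real n)) * ?bd"
    by (intro mult_mono V) auto
  also have "\<dots> = exp (2 + (k + l) * ln (real n) + x * (k\<^sup>2 + real n * l) + real m * ln (1 / x))"
    by (simp add: exp_add[symmetric] algebra_simps)
  finally show ?thesis .
qed

text \<open>
  The exponent of the count is at most \<open>3 m \<Lambda> / 4\<close>, against \<open>p ^ m = exp (- m \<Lambda>)\<close>. Choosing the edges
  with \<open>x = sqrt p\<close> costs \<open>m \<Lambda> / 2\<close>, and each of the four other terms costs at most \<open>m \<Lambda> / 16\<close>: the
  constant \<open>2\<close> since \<open>\<Lambda>\<close> is large, the two vertex choices since \<open>n p\<close> exceeds a multiple of \<open>ln n\<close>,
  and the size of the region since it is \<open>m\<close> times a polynomial in \<open>\<Lambda>\<close>, which \<open>sqrt p\<close> beats.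
\<close>
lemma heavy_edge_graphs_weight_le:
  fixes p \<delta> :: real and n m :: nat
  defines "\<Lambda> \<equiv> ln (1 / p)"
  defines "b \<equiv> \<delta> * real n / (4 * \<Lambda>)"
  assumes p: "0 < p" "p < 1" and n: "0 < n" and m: "0 < m" and \<delta>: "0 < \<delta>"
    and m_le: "real m \<le> 6 * ((real n)\<^sup>2 * p\<^sup>2 * \<Lambda>)"
    and np: "128 * ln (real n) \<le> \<delta> * (real n * p)"
    and \<Lambda>: "32 \<le> \<Lambda>"
    and small: "sqrt p * (384 * \<Lambda>\<^sup>2 / \<delta>\<^sup>2 + 8 / \<delta>) \<le> 1 / 16"
  shows "real (card (heavy_edge_graphs n (p * b) b m)) * p ^ m \<le> exp (- (real m * \<Lambda> / 4))"
proof -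
  define k l where "k = 2 * real m / (p * b)" and "l = 2 * real m / b"
  have bpos: "0 < b" using \<delta> n \<Lambda> by (simp add: b_def)
  have k_eq: "k = 8 * real m * \<Lambda> / (\<delta> * (real n * p))"
    using \<delta> n \<Lambda> p by (simp add: k_def b_def field_simps)
  have l_eq: "l = 8 * real m * \<Lambda> / (\<delta> * real n)"
    using \<delta> n \<Lambda> by (simp add: l_def b_def field_simps)
  have m\<Lambda>: "32 \<le> real m * \<Lambda>"
    using mult_mono[of 1 "real m" 32 \<Lambda>] m \<Lambda> by simp
  have lk: "l \<le> k"
    using p bpos by (simp add: l_def k_def frac_le mult_le_cancel_right1)
  have k_ln: "k * ln (real n) \<le> real m * \<Lambda> / 16"
  proof -
    have "k * ln (real n) = real m * \<Lambda> * (8 * ln (real n) / (\<delta> * (real n * p)))"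
      by (simp add: k_eq)
    also have "\<dots> \<le> real m * \<Lambda> * (1 / 16)"
      using np \<delta> n p m\<Lambda> by (intro mult_left_mono) (auto simp: pos_divide_le_eq)
    finally show ?thesis by simp
  qed
  have "l * ln (real n) \<le> k * ln (real n)"
    using lk n by (intro mult_right_mono) auto
  then have kl: "(k + l) * ln (real n) \<le> real m * \<Lambda> / 8"
    using k_ln by (simp add: distrib_right)
  have k2: "k\<^sup>2 \<le> real m * (384 * \<Lambda> ^ 3 / \<delta>\<^sup>2)"
  proof -
    have "k\<^sup>2 = real m * (64 * \<Lambda>\<^sup>2 / \<delta>\<^sup>2) * (real m / ((real n)\<^sup>2 * p\<^sup>2))"
      by (simp add: k_eq power2_eq_square mult_ac)
    also have "\<dots> \<le> real m * (64 * \<Lambda>\<^sup>2 / \<delta>\<^sup>2) * (6 * \<Lambda>)"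
      using m_le n p by (intro mult_left_mono) (auto simp: pos_divide_le_eq mult_ac)
    finally show ?thesis by (simp add: power2_eq_square power3_eq_cube mult_ac)
  qed
  have nl: "real n * l = real m * (8 * \<Lambda> / \<delta>)"
    using n by (simp add: l_eq)
  have "sqrt p * (k\<^sup>2 + real n * l) \<le> sqrt p * (real m * (384 * \<Lambda> ^ 3 / \<delta>\<^sup>2) + real m * (8 * \<Lambda> / \<delta>))"
    using k2 p by (simp add: nl)
  also have "\<dots> = real m * \<Lambda> * (sqrt p * (384 * \<Lambda>\<^sup>2 / \<delta>\<^sup>2 + 8 / \<delta>))"
    by (simp add: power2_eq_square power3_eq_cube algebra_simps)
  also have "\<dots> \<le> real m * \<Lambda> * (1 / 16)"
    using small m\<Lambda> by (intro mult_left_mono) auto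
  finally have reg: "sqrt p * (k\<^sup>2 + real n * l) \<le> real m * \<Lambda> / 16" by simp
  have half: "ln (1 / sqrt p) = \<Lambda> / 2"
    using p by (simp add: \<Lambda>_def ln_div ln_sqrt)
  have pm: "p ^ m = exp (- (real m * \<Lambda>))"
    using p by (simp add: \<Lambda>_def ln_div exp_of_nat_mult)
  have "real (card (heavy_edge_graphs n (p * b) b m)) * p ^ m
      \<le> exp (2 + (k + l) * ln (real n) + sqrt p * (k\<^sup>2 + real n * l) + real m * (\<Lambda> / 2)) * p ^ m"
    using card_heavy_edge_graphs_le[OF n _ bpos _ _ k_def l_def, of "sqrt p"] p bpos
    by (intro mult_right_mono) (auto simp: half)
  also have "\<dots> = exp (2 + (k + l) * ln (real n) + sqrt p * (k\<^sup>2 + real n * l) - real m * \<Lambda> / 2)"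
    by (simp add: pm exp_add[symmetric])
  also have "\<dots> \<le> exp (- (real m * \<Lambda> / 4))"
    using kl reg m\<Lambda> by simp
  finally show ?thesis .
qed

section \<open>The upper tail of the triangle count\<close>

context triangle_count
begin

text \<open>
  If both degrees were below \<open>b\<close> and one of them even below \<open>p b\<close>, then
  \<open>cond_mean_remove_edge_le\<close> would bound the influence of the edge strictly by \<open>n p\<^sup>2 + 3 p b\<close>.
\<close>
lemma core_edge_heavy:
  assumes J: "J \<in> cores L \<tau> \<theta>" and e: "e \<in> J"
    and \<theta>: "real n * p\<^sup>2 + 3 * (p * b) \<le> \<theta>"
  shows "e \<subseteq> heavy n J (p * b) \<or> e \<inter> heavy n J b \<noteq> {}"
proof (rule ccontr)
  assume contra: "\<not> ?thesis"
  have sub: "J \<subseteq> all_edges n" using J by (simp add: cores_def)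
  then have edge: "e \<in> all_edges n" using e by blast
  obtain v where v: "v \<in> e" "v \<notin> heavy n J (p * b)" using contra by blast
  obtain u where u: "e = {u, v}" "u < n" "v < n" using edgeE[OF edge v(1)] by metis
  have dv: "real (degree J v) < p * b" using v u by (simp add: heavy_def)
  have "real (degree J u) < b" "real (degree J v) < b"
    using contra u by (auto simp: heavy_def)
  then have "p * (real (degree J u) + real (degree J v)) \<le> p * (b + b)"
    using p_pos by (intro mult_left_mono) auto
  then have "real n * p\<^sup>2 + p * (real (degree J u) + real (degree J v)) + real (degree J v) < \<theta>"
    using dv \<theta> by (simp add: distrib_left)
  moreover have "cond_mean J - cond_mean (J - {{u, v}})
      \<le> real n * p\<^sup>2 + p * (real (degree J u) + real (degree J v)) + real (degree J v)"
    using cond_mean_remove_edge_le[OF sub] e u(1) by simp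
  moreover have "\<theta> \<le> cond_mean J - cond_mean (J - {{u, v}})"
    using J e u(1) by (simp add: cores_def)
  ultimately show False by linarith
qed

text \<open>
  With at most \<open>c (n p)\<^sup>2\<close> edges, \<open>cond_mean_excess_le\<close> for \<open>s = sqrt c n p\<close> allows an excess of at most
  \<open>c (n p)\<^sup>2 (n p + 2 s) \<le> 3 c (n p) ^ 3\<close>.
\<close>
lemma core_card_gt:
  assumes J: "J \<in> cores L \<tau> \<theta>" and c: "0 \<le> c" "c \<le> 1"
    and \<tau>: "cond_mean {} + 3 * c * (real n * p) ^ 3 < \<tau>"
  shows "c * ((real n)\<^sup>2 * p\<^sup>2) < real (card J)"
proof (rule ccontr)
  assume "\<not> ?thesis"
  then have small: "real (card J) \<le> c * (real n * p)\<^sup>2" by (simp add: power_mult_distrib)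
  define s where "s = sqrt c * (real n * p)"
  have s2: "s\<^sup>2 = c * (real n * p)\<^sup>2" using c by (simp add: s_def power_mult_distrib)
  have np: "0 \<le> real n * p" using p_pos by simp
  have s0: "0 \<le> s" and s1: "s \<le> real n * p"
    using c np by (auto simp: s_def intro: mult_left_le_one_le)
  have "\<tau> - cond_mean {} \<le> cond_mean J - cond_mean {}" using J by (simp add: cores_def)
  also have "\<dots> \<le> real (card J) * (p * real n + 2 * s)"
    using J small by (intro cond_mean_excess_le s0) (auto simp: cores_def s2)
  also have "\<dots> \<le> c * (real n * p)\<^sup>2 * (3 * (real n * p))"
    using small s0 s1 np c by (intro mult_mono) (auto simp: mult.commute)
  also have "\<dots> = 3 * c * (real n * p) ^ 3"
    by (simp add: power2_eq_square power3_eq_cube)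
  finally show False using \<tau> by linarith
qed

text \<open>
  The cores are grouped by their number \<open>m\<close> of edges. Groups with \<open>m \<le> c n\<^sup>2 p\<^sup>2\<close> are empty, and each
  other group has total weight at most \<open>exp (- m \<Lambda> / 4)\<close>.
\<close>
lemma sum_cores_le:
  fixes \<delta> c \<tau> \<theta> :: real
  defines "\<Lambda> \<equiv> ln (1 / p)"
  assumes n: "0 < n" and \<delta>: "0 < \<delta>" and c: "0 < c" "c \<le> 1"
    and L: "real L \<le> 6 * ((real n)\<^sup>2 * p\<^sup>2 * \<Lambda>)"
    and np: "128 * ln (real n) \<le> \<delta> * (real n * p)"
    and \<Lambda>: "32 \<le> \<Lambda>"
    and small: "sqrt p * (384 * \<Lambda>\<^sup>2 / \<delta>\<^sup>2 + 8 / \<delta>) \<le> 1 / 16"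
    and p_small: "p * \<Lambda> \<le> \<delta> / 4"
    and \<theta>: "\<delta> * (real n * p) / \<Lambda> \<le> \<theta>"
    and \<tau>: "cond_mean {} + 3 * c * (real n * p) ^ 3 < \<tau>"
  shows "(\<Sum>J\<in>cores L \<tau> \<theta>. p ^ card J)
    \<le> (real L + 1) * exp (- (c * ((real n)\<^sup>2 * p\<^sup>2 * \<Lambda>) / 4))"
proof -
  define b where "b = \<delta> * real n / (4 * \<Lambda>)"
  let ?bd = "exp (- (c * ((real n)\<^sup>2 * p\<^sup>2 * \<Lambda>) / 4))"
  have \<theta>': "real n * p\<^sup>2 + 3 * (p * b) \<le> \<theta>"
  proof -
    have "real n * p\<^sup>2 = real n * p * (p * \<Lambda>) / \<Lambda>"
      using \<Lambda> by (simp add: power2_eq_square)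
    also have "\<dots> \<le> real n * p * (\<delta> / 4) / \<Lambda>"
      using p_small \<Lambda> p_pos by (intro divide_right_mono mult_left_mono) auto
    finally have "real n * p\<^sup>2 + 3 * (p * b) \<le> \<delta> * (real n * p) / \<Lambda>"
      using \<Lambda> by (simp add: b_def field_simps)
    then show ?thesis using \<theta> by linarith
  qed
  have class_le: "(\<Sum>J\<in>{J \<in> cores L \<tau> \<theta>. card J = m}. p ^ card J) \<le> ?bd" if m: "m \<le> L" for m
  proof (cases "{J \<in> cores L \<tau> \<theta>. card J = m} = {}")
    case True
    then show ?thesis by (simp only: sum.empty) simp
  next
    case False
    then obtain J where "J \<in> cores L \<tau> \<theta>" "card J = m" by blast
    then have m_gt: "c * ((real n)\<^sup>2 * p\<^sup>2) < real m"
      using core_card_gt[of J L \<tau> \<theta> c] c \<tau> by simp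
    have "0 \<le> c * ((real n)\<^sup>2 * p\<^sup>2)" using c by simp
    then have m_pos: "0 < m" using m_gt by linarith
    have "{J \<in> cores L \<tau> \<theta>. card J = m} \<subseteq> heavy_edge_graphs n (p * b) b m"
    proof
      fix J assume J: "J \<in> {J \<in> cores L \<tau> \<theta>. card J = m}"
      then have "J \<subseteq> all_edges n" by (simp add: cores_def)
      then show "J \<in> heavy_edge_graphs n (p * b) b m"
        using core_edge_heavy[OF _ _ \<theta>', of J L \<tau>] J by (simp add: heavy_edge_graphs_def)
    qed
    moreover have "finite (heavy_edge_graphs n (p * b) b m)"
      by (rule finite_subset[of _ "Pow (all_edges n)"])
        (auto simp: heavy_edge_graphs_def finite_all_edges)
    ultimately have "card {J \<in> cores L \<tau> \<theta>. card J = m} \<le> card (heavy_edge_graphs n (p * b) b m)"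
      by (rule card_mono[rotated])
    then have "(\<Sum>J\<in>{J \<in> cores L \<tau> \<theta>. card J = m}. p ^ card J)
        \<le> real (card (heavy_edge_graphs n (p * b) b m)) * p ^ m"
      using p_pos by (simp add: mult_right_mono)
    also have "\<dots> \<le> exp (- (real m * \<Lambda> / 4))"
    proof -
      have "real m \<le> 6 * ((real n)\<^sup>2 * p\<^sup>2 * \<Lambda>)" using m L by linarith
      then show ?thesis
        using heavy_edge_graphs_weight_le[of p n m \<delta>] p_pos p_less_1 n m_pos \<delta> np \<Lambda> small
        unfolding \<Lambda>_def b_def by blast
    qed
    also have "\<dots> \<le> ?bd"
    proof -
      have "c * ((real n)\<^sup>2 * p\<^sup>2) * \<Lambda> \<le> real m * \<Lambda>"
        using m_gt \<Lambda> by (intro mult_right_mono) auto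
      then show ?thesis by (simp add: mult.assoc)
    qed
    finally show ?thesis .
  qed
  have "(\<Sum>J\<in>cores L \<tau> \<theta>. p ^ card J)
      = (\<Sum>m\<in>{..L}. \<Sum>J\<in>{J \<in> cores L \<tau> \<theta>. card J = m}. p ^ card J)"
    by (rule sum.group[symmetric]) (auto simp: finite_cores, auto simp: cores_def)
  also have "\<dots> \<le> (\<Sum>m\<in>{..L}. ?bd)"
    by (intro sum_mono class_le) simp
  also have "\<dots> = (real L + 1) * ?bd"
    by (simp add: add.commute)
  finally show ?thesis .
qed

lemma expected_triangles_ge:
  assumes "3 \<le> n"
  shows "(real n * p) ^ 3 / 27 \<le> cond_mean {}"
proof -
  have "(real n / 3) ^ 3 \<le> real (n choose 3)"
    using binomial_ge_n_over_k_pow_k[OF assms, where ?'a = real] by simp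
  then have "(real n / 3) ^ 3 * p ^ 3 \<le> real (n choose 3) * p ^ 3"
    using p_pos by (intro mult_right_mono) auto
  then show ?thesis by (simp add: cond_mean_empty power_mult_distrib power_divide)
qed

text \<open>
  The constant \<open>648 = 4 * 27 * 6\<close> is forced by \<open>\<theta> = \<epsilon> \<mu> / (4 * 3 k)\<close>, where \<open>\<mu> \<ge> (n p) ^ 3 / 27\<close> and
  \<open>3 k \<le> 6 r\<close>; and \<open>c\<close> is chosen so that \<open>3 c < \<epsilon> / (4 * 27)\<close>, which makes cores large.
\<close>
lemma triangle_tail_le:
  fixes \<epsilon> :: real
  defines "\<Lambda> \<equiv> ln (1 / p)" and "\<delta> \<equiv> \<epsilon> / 648" and "c \<equiv> min 1 (\<epsilon> / 400)"
  defines "r \<equiv> (real n)\<^sup>2 * p\<^sup>2 * \<Lambda>"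
  assumes \<epsilon>: "0 < \<epsilon>" and n: "3 \<le> n" and r: "1 \<le> r"
    and np: "128 * ln (real n) \<le> \<delta> * (real n * p)"
    and \<Lambda>: "32 \<le> \<Lambda>"
    and small: "sqrt p * (384 * \<Lambda>\<^sup>2 / \<delta>\<^sup>2 + 8 / \<delta>) \<le> 1 / 16"
    and p_small: "p * \<Lambda> \<le> \<delta> / 4"
  shows "measure_pmf.prob (gnp n p) {G. (1 + \<epsilon>) * cond_mean {} \<le> real (count G)}
    \<le> exp (- (ln ((1 + \<epsilon>) / (1 + \<epsilon> / 2)) * r)) + 7 * r * exp (- (c * r / 4))"
proof -
  define \<mu> where "\<mu> = cond_mean {}"
  define k where "k = nat \<lceil>r\<rceil>"
  \<comment> \<open>Deleting up to \<open>3 k\<close> edges of influence below \<open>\<theta>\<close> loses at most \<open>\<epsilon> \<mu> / 4\<close>, half of the excess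
    of a seed.\<close>
  define \<theta> where "\<theta> = \<epsilon> * \<mu> / (4 * real (3 * k))"
  define \<tau> where "\<tau> = (1 + \<epsilon> / 2) * \<mu>"
  have k_ge: "r \<le> real k" and k_le: "real k \<le> 2 * r" and k_le1: "real k \<le> r + 1" and k_pos: "0 < k"
    using r unfolding k_def by linarith+
  have np_pos: "0 < real n * p" using n p_pos by simp
  have \<mu>_ge: "(real n * p) ^ 3 / 27 \<le> \<mu>"
    using expected_triangles_ge[OF n] by (simp add: \<mu>_def)
  have \<mu>_pos: "0 < \<mu>" using \<mu>_ge zero_less_power[OF np_pos, of 3] by linarith
  have \<theta>L: "\<tau> - \<theta> * real (3 * k) = (1 + \<epsilon> / 4) * \<mu>"
    using k_pos by (simp add: \<theta>_def \<tau>_def field_simps)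
  have \<theta>_ge: "\<delta> * (real n * p) / \<Lambda> \<le> \<theta>"
  proof -
    have "\<delta> * (real n * p) / \<Lambda> = \<epsilon> * ((real n * p) ^ 3 / 27) / (4 * (3 * (2 * r)))"
      using np_pos \<Lambda> by (simp add: \<delta>_def r_def power2_eq_square power3_eq_cube field_simps)
    also have "\<dots> \<le> \<epsilon> * \<mu> / (4 * (3 * real k))"
      using \<epsilon> \<mu>_ge \<mu>_pos k_le k_pos by (intro frac_le mult_left_mono) auto
    finally show ?thesis by (simp add: \<theta>_def)
  qed
  have \<tau>': "cond_mean {} + 3 * c * (real n * p) ^ 3 < \<tau> - \<theta> * real (3 * k)"
  proof -
    have "3 * c * (real n * p) ^ 3 \<le> 3 * (\<epsilon> / 400) * (real n * p) ^ 3"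
      using np_pos by (intro mult_right_mono) (auto simp: c_def)
    also have "\<dots> < \<epsilon> / 4 * ((real n * p) ^ 3 / 27)"
      using \<epsilon> zero_less_power[OF np_pos, of 3] by (simp add: field_simps)
    also have "\<dots> \<le> \<epsilon> / 4 * \<mu>"
      using \<epsilon> \<mu>_ge by (intro mult_left_mono) auto
    finally show ?thesis unfolding \<theta>L \<mu>_def by (simp add: distrib_right)
  qed
  have c: "0 < c" "c \<le> 1" using \<epsilon> by (auto simp: c_def)
  have "measure_pmf.prob (gnp n p) {G. (1 + \<epsilon>) * \<mu> \<le> real (count G)}
      \<le> (\<tau> / ((1 + \<epsilon>) * \<mu>)) ^ k
        + (\<Sum>J\<in>cores (3 * k) (\<tau> - \<theta> * real (3 * k)) \<theta>. p ^ card J)"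
    using \<epsilon> \<mu>_pos by (intro upper_tail_le) (auto simp: card_pairs_triple \<tau>_def \<theta>_def)
  also have "(\<Sum>J\<in>cores (3 * k) (\<tau> - \<theta> * real (3 * k)) \<theta>. p ^ card J)
      \<le> (real (3 * k) + 1) * exp (- (c * r / 4))"
    unfolding r_def \<Lambda>_def
  proof (rule sum_cores_le[where \<delta> = \<delta>])
    show "real (3 * k) \<le> 6 * ((real n)\<^sup>2 * p\<^sup>2 * ln (1 / p))"
      using k_le unfolding r_def \<Lambda>_def by linarith
  qed (use n \<epsilon> c np \<Lambda> small p_small \<theta>_ge \<tau>' in \<open>simp_all add: \<Lambda>_def \<delta>_def\<close>)
  also have "\<dots> \<le> 7 * r * exp (- (c * r / 4))"
    using k_le1 r by (intro mult_right_mono) auto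
  also have "(\<tau> / ((1 + \<epsilon>) * \<mu>)) ^ k \<le> exp (- (ln ((1 + \<epsilon>) / (1 + \<epsilon> / 2)) * r))"
  proof -
    let ?q = "(1 + \<epsilon>) / (1 + \<epsilon> / 2)"
    have q: "1 < ?q" using \<epsilon> by (simp add: pos_less_divide_eq)
    have "\<tau> / ((1 + \<epsilon>) * \<mu>) = 1 / ?q" using \<mu>_pos by (simp add: \<tau>_def)
    also have "\<dots> = exp (- ln ?q)" using q by (simp add: exp_minus inverse_eq_divide)
    finally have "(\<tau> / ((1 + \<epsilon>) * \<mu>)) ^ k = exp (- (ln ?q * real k))"
      by (simp add: exp_of_nat_mult[symmetric] mult.commute)
    moreover have "ln ?q * r \<le> ln ?q * real k"
      using q k_ge by (intro mult_left_mono) auto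
    ultimately show ?thesis by simp
  qed
  finally show ?thesis by (simp add: \<mu>_def)
qed

end

theorem theorem1p1:
  fixes \<epsilon> :: real
  assumes "\<epsilon> > 0"
  shows "\<exists>C1 C2 C3 :: real. C1 > 0 \<and> C2 > 0 \<and> C3 > 0 \<and>
    (\<forall>(n :: nat) (p :: real).
       n \<ge> 2 \<longrightarrow> 0 < p \<longrightarrow> p < 1 \<longrightarrow>
       C1 * (1 / real n) * ln (real n) \<le> p \<longrightarrow> p \<le> C2 \<longrightarrow>
       measure_pmf.prob (gnp n p)
         {G. real (num_triangles n G)
               \<ge> (1 + \<epsilon>) * measure_pmf.expectation (gnp n p) (\<lambda>H. real (num_triangles n H))}
       \<le> exp (- (C3 * (real n)\<^sup>2 * p\<^sup>2 * ln (1 / p))))"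
proof -
  define \<delta> c h where "\<delta> = \<epsilon> / 648" and "c = min 1 (\<epsilon> / 400)"
    and "h = min (ln ((1 + \<epsilon>) / (1 + \<epsilon> / 2))) (c / 4)"
  have \<delta>: "0 < \<delta>" using assms by (simp add: \<delta>_def)
  have "1 < (1 + \<epsilon>) / (1 + \<epsilon> / 2)" using assms by (simp add: pos_less_divide_eq)
  then have h: "0 < h" using assms by (simp add: h_def c_def)
  \<comment> \<open>Half of the exponent \<open>h\<close> pays for the polynomial factor; for this \<open>r\<close> has to be large, which a
    large \<open>C1\<close> ensures.\<close>
  have "eventually (\<lambda>r::real. 1 + 7 * r \<le> exp (h / 2 * r)) at_top"
    using h by real_asymp
  then obtain r0 where r0: "\<And>r. r0 \<le> r \<Longrightarrow> 1 + 7 * r \<le> exp (h / 2 * r)"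
    by (auto simp: eventually_at_top_linorder)
  have "eventually (\<lambda>p::real. 32 \<le> ln (1 / p)) (at_right 0)"
    by real_asymp
  moreover have "((\<lambda>p::real. p * ln (1 / p)) \<longlongrightarrow> 0) (at_right 0)"
    by real_asymp
  then have "eventually (\<lambda>p::real. p * ln (1 / p) < \<delta> / 4) (at_right 0)"
    by (rule order_tendstoD(2)) (use \<delta> in simp)
  moreover have "((\<lambda>p::real. sqrt p * (384 * (ln (1 / p))\<^sup>2 / \<delta>\<^sup>2 + 8 / \<delta>)) \<longlongrightarrow> 0) (at_right 0)"
    using \<delta> by real_asymp
  then have "eventually (\<lambda>p::real. sqrt p * (384 * (ln (1 / p))\<^sup>2 / \<delta>\<^sup>2 + 8 / \<delta>) < 1 / 16) (at_right 0)"
    by (rule order_tendstoD(2)) simp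
  ultimately have "eventually (\<lambda>p::real. 32 \<le> ln (1 / p) \<and> p * ln (1 / p) < \<delta> / 4 \<and>
      sqrt p * (384 * (ln (1 / p))\<^sup>2 / \<delta>\<^sup>2 + 8 / \<delta>) < 1 / 16) (at_right 0)"
    by eventually_elim simp
  then obtain p0 where p0: "0 < p0" "\<And>p. 0 < p \<Longrightarrow> p < p0 \<Longrightarrow> 32 \<le> ln (1 / p) \<and>
      p * ln (1 / p) < \<delta> / 4 \<and> sqrt p * (384 * (ln (1 / p))\<^sup>2 / \<delta>\<^sup>2 + 8 / \<delta>) < 1 / 16"
    unfolding eventually_at_right_field by auto
  define C1 C2 where "C1 = 4 + 128 / \<delta> + 2 * \<bar>r0\<bar>" and "C2 = p0 / 2"
  have C1: "4 \<le> C1" "128 / \<delta> \<le> C1" "2 * r0 \<le> C1" 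
  proof -
    have "0 < 128 / \<delta>" using \<delta> by simp
    then show "4 \<le> C1" "128 / \<delta> \<le> C1" "2 * r0 \<le> C1" unfolding C1_def by linarith+
  qed
  have "measure_pmf.prob (gnp n p)
         {G. real (num_triangles n G)
               \<ge> (1 + \<epsilon>) * measure_pmf.expectation (gnp n p) (\<lambda>H. real (num_triangles n H))}
       \<le> exp (- (h / 2 * (real n)\<^sup>2 * p\<^sup>2 * ln (1 / p)))"
    if n2: "2 \<le> n" and p: "0 < p" "p < 1" and lower: "C1 * (1 / real n) * ln (real n) \<le> p"
      and upper: "p \<le> C2" for n :: nat and p :: real
  proof -
    interpret triangle_count n p
      using p by unfold_locales
    define r where "r = (real n)\<^sup>2 * p\<^sup>2 * ln (1 / p)"
    have small: "32 \<le> ln (1 / p)" "p * ln (1 / p) \<le> \<delta> / 4"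
      "sqrt p * (384 * (ln (1 / p))\<^sup>2 / \<delta>\<^sup>2 + 8 / \<delta>) \<le> 1 / 16"
      using p0(2)[of p] p p0(1) upper by (auto simp: C2_def)
    have lower': "C1 * ln (real n) \<le> real n * p"
      using lower n2 by (simp add: field_simps)
    have ln2: "1 / 2 \<le> ln (2::real)" using ln2_ge_two_thirds by simp
    have "ln 2 \<le> ln (real n)" using n2 by simp
    then have lnn: "1 / 2 \<le> ln (real n)" using ln2 by linarith
    have "C1 * (1 / 2) \<le> C1 * ln (real n)"
      using lnn C1(1) by (intro mult_left_mono) auto
    then have np_ge: "C1 / 2 \<le> real n * p" using lower' by linarith
    \<comment> \<open>For \<open>n = 2\<close> both sides of \<open>T \<ge> (1 + \<epsilon>) \<mu>\<close> are zero and the bound would fail; a large \<open>C1\<close>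
      makes the range of \<open>p\<close> empty.\<close>
    have "n \<noteq> 2"
    proof
      assume "n = 2"
      then have "C1 / 2 \<le> 2 * p" using np_ge by simp
      then show False using C1(1) p(2) by linarith
    qed
    then have n3: "3 \<le> n" using n2 by linarith
    have np: "128 * ln (real n) \<le> \<delta> * (real n * p)"
    proof -
      have "128 / \<delta> * ln (real n) \<le> C1 * ln (real n)"
        using C1(2) lnn by (intro mult_right_mono) auto
      then have "128 / \<delta> * ln (real n) \<le> real n * p" using lower' by linarith
      then show ?thesis using \<delta> by (simp add: field_simps)
    qed
    have r_ge: "C1 / 2 \<le> r"
    proof -
      have np1: "1 \<le> real n * p" using np_ge C1(1) by linarith
      have "C1 / 2 * 1 * 1 \<le> (real n * p) * (real n * p) * ln (1 / p)"
        using np_ge np1 small(1) C1(1) by (intro mult_mono) auto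
      then show ?thesis by (simp add: r_def power2_eq_square mult_ac)
    qed
    have r1: "1 \<le> r" and rr0: "r0 \<le> r" using r_ge C1 by linarith+
    have "measure_pmf.prob (gnp n p) {G. (1 + \<epsilon>) * cond_mean {} \<le> real (count G)}
        \<le> exp (- (ln ((1 + \<epsilon>) / (1 + \<epsilon> / 2)) * r)) + 7 * r * exp (- (c * r / 4))"
      unfolding r_def c_def
      by (rule triangle_tail_le)
        (use assms n3 r1 np small in \<open>simp_all add: r_def \<delta>_def\<close>)
    also have "\<dots> \<le> exp (- (h * r)) + 7 * r * exp (- (h * r))"
    proof -
      have "h * r \<le> ln ((1 + \<epsilon>) / (1 + \<epsilon> / 2)) * r" "h * r \<le> c / 4 * r"
        using r1 by (auto simp: h_def intro: mult_right_mono)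
      then show ?thesis using r1 by (intro add_mono mult_left_mono) auto
    qed
    also have "\<dots> = (1 + 7 * r) * exp (- (h * r))"
      by (simp add: distrib_right)
    also have "\<dots> \<le> exp (h / 2 * r) * exp (- (h * r))"
      by (intro mult_right_mono r0 rr0) simp
    also have "\<dots> = exp (- (h / 2 * r))"
      by (simp add: exp_add[symmetric])
    finally show ?thesis
      unfolding num_triangles_eq_count expectation_count by (simp add: r_def mult.assoc)
  qed
  moreover have "0 < C1" "0 < C2" "0 < h / 2"
    using C1(1) p0(1) h by (auto simp: C2_def)
  ultimately show ?thesis by blast
qed

end
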